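(* Let $\mathcal{H}$ be a hypothesis class on $\mathcal{P}$ and $\varepsilon$ an E-function for $\mathcal{H}$. For every $\mathcal{H}$-order-measurable $f:\mathcal{P}\to[0,\infty]$, $$\int^E f\,d\varepsilon=\int^E\sup_{c>0}c\,\mathbf{1}\{f\ge c\}\,d\varepsilon=\sup_{c>0}\int^E c\,\mathbf{1}\{f\ge c\}\,d\varepsilon=\sup_{c>0}\frac{c}{\varepsilon(\{f\ge c\})}.$$
   Context: $\mathcal{P}$ is a collection of probability measures on a measurable space. A hypothesis class $\mathcal{H}$ is a collection of subsets of $\mathcal{P}$ closed under arbitrary unions (including the empty union, so $\emptyset\in\mathcal{H}$). An E-function is a map $\varepsilon:\mathcal{H}\to[0,\infty]$ with $\varepsilon(\emptyset)=\infty$. A function $f:\mathcal{P}\to[0,\infty]$ is $\mathcal{H}$-order-measurable if $\{f\ge c\}=\{P\in\mathcal{P}:f(P)\ge c\}\in\mathcal{H}$ for all $c>0$. The E-integral of such $f$ with respect to $\varepsilon$ is $\int^E f\,d\varepsilon=\sup_{c>0}\frac{c}{\varepsilon(\{f\ge c\})}$, with $c$ ranging over positive reals. Here $\mathbf{1}\{f\ge c\}$ denotes the function on $\mathcal{P}$ equal to $1$ where $f\ge c$ and $0$ elsewhere, and $\sup_{c>0}c\,\mathbf{1}\{f\ge c\}$ is a pointwise supremum. Conventions: $c/0=\infty$ and $c/\infty=0$ for $c>0$. *)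

theory Defs
  imports "HOL-Probability.Giry_Monad"
begin

definition hypothesis_class :: "'a measure set \<Rightarrow> 'a measure set set \<Rightarrow> bool" where
  "hypothesis_class P H \<longleftrightarrow> H \<subseteq> Pow P \<and> (\<forall>A. A \<subseteq> H \<longrightarrow> \<Union>A \<in> H)"

text \<open>
  An E-function is a map on a hypothesis class \<open>H\<close>. It is represented by a total function
  whose values outside \<open>H\<close> are arbitrary, so \<open>H\<close> is not a parameter here.
\<close>
definition E_function :: "('a measure set \<Rightarrow> ennreal) \<Rightarrow> bool" where
  "E_function \<epsilon> \<longleftrightarrow> \<epsilon> {} = \<infinity>"

definition superlevel :: "'a measure set \<Rightarrow> ('a measure \<Rightarrow> ennreal) \<Rightarrow> real \<Rightarrow> 'a measure set" where
  "superlevel P f c = {Q \<in> P. f Q \<ge> ennreal c}"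

definition order_measurable ::
  "'a measure set \<Rightarrow> 'a measure set set \<Rightarrow> ('a measure \<Rightarrow> ennreal) \<Rightarrow> bool" where
  "order_measurable P H f \<longleftrightarrow> (\<forall>c::real. c > 0 \<longrightarrow> superlevel P f c \<in> H)"

text \<open>
  Division on \<^typ>\<open>ennreal\<close> satisfies \<open>c / 0 = \<infinity>\<close> and \<open>c / \<infinity> = 0\<close> for \<open>0 < c < \<infinity>\<close>.
  The value is meaningful when \<open>f\<close> is order-measurable, since \<open>\<epsilon>\<close> is then only evaluated
  on members of the hypothesis class; only the values of \<open>f\<close> on \<open>P\<close> matter.
\<close>
definition E_integral ::
  "'a measure set \<Rightarrow> ('a measure set \<Rightarrow> ennreal) \<Rightarrow> ('a measure \<Rightarrow> ennreal) \<Rightarrow> ennreal" where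
  "E_integral P \<epsilon> f = (SUP c\<in>{0::real<..}. ennreal c / \<epsilon> (superlevel P f c))"

end

theory Submission
  imports Defs
begin

text \<open>On \<open>P\<close> the supremum of the functions c * 1{f \<ge> c} is f itself
  (layer-cake representation, \<open>SUP_superlevel_eq\<close>), so the first equality compares
  integrals of functions that agree on \<open>P\<close>. The integral of a single layer is c /
  \<epsilon>({f \<ge> c}) (\<open>E_integral_scaled_indicator\<close>), so the supremum over the
  layers is literally the definition of the E-integral of f.\<close>

lemma superlevel_cong:
  assumes "\<And>Q. Q \<in> P \<Longrightarrow> f Q = g Q"
  shows "superlevel P f = superlevel P g"
  using assms by (auto simp: superlevel_def fun_eq_iff)

text \<open>A layer contributes c at Q exactly when c \<le> f Q, and f Q is the supremum of the
  positive reals below or equal to it.\<close>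

lemma SUP_superlevel_eq:
  assumes "Q \<in> P"
  shows "(SUP c\<in>{0::real<..}. ennreal c * indicator (superlevel P f c) Q) = f Q"
proof (rule antisym)
  show "(SUP c\<in>{0::real<..}. ennreal c * indicator (superlevel P f c) Q) \<le> f Q"
    by (rule SUP_least) (auto simp: superlevel_def indicator_def)
  show "f Q \<le> (SUP c\<in>{0::real<..}. ennreal c * indicator (superlevel P f c) Q)"
  \<comment> \<open>The levels c are real but f Q may be infinite; approximating from strictly below
    leaves only finite y to handle.\<close>
  proof (rule dense_le)
    fix y assume y: "y < f Q"
    then have "y \<noteq> top"
      by auto
    then obtain r where r: "0 \<le> r" "y = ennreal r"
      by (cases y) auto
    show "y \<le> (SUP c\<in>{0::real<..}. ennreal c * indicator (superlevel P f c) Q)"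
    \<comment> \<open>Only positive levels are indices: 0 is a trivial bound, and any other r serves
      as its own level.\<close>
    proof (cases "r = 0")
      case True
      then show ?thesis using r by simp
    next
      case False
      have "y = ennreal r * indicator (superlevel P f r) Q"
        using r y assms by (simp add: superlevel_def)
      also have "\<dots> \<le> (SUP c\<in>{0::real<..}. ennreal c * indicator (superlevel P f c) Q)"
        using r False by (intro SUP_upper) auto
      finally show ?thesis .
    qed
  qed
qed

text \<open>Positivity of d excludes the points outside A, where the function is 0; at d = 0 the
  superlevel set would be all of \<open>P\<close>.\<close>

lemma superlevel_scaled_indicator:
  assumes "0 < d" "A \<subseteq> P"
  shows "superlevel P (\<lambda>Q. ennreal c * indicator A Q) d = (if d \<le> c then A else {})"
  using assms by (auto simp: superlevel_def indicator_def ennreal_le_iff2)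

text \<open>Levels d \<le> c give d / \<epsilon> A, largest at d = c; levels d > c give the empty
  set, where \<epsilon> is infinite and the quotient vanishes.\<close>

lemma E_integral_scaled_indicator:
  assumes "E_function \<epsilon>" "0 < c" "A \<subseteq> P"
  shows "E_integral P \<epsilon> (\<lambda>Q. ennreal c * indicator A Q) = ennreal c / \<epsilon> A"
proof (rule antisym)
  show "E_integral P \<epsilon> (\<lambda>Q. ennreal c * indicator A Q) \<le> ennreal c / \<epsilon> A"
    unfolding E_integral_def
  proof (rule SUP_least)
    fix d :: real assume "d \<in> {0<..}"
    then show "ennreal d / \<epsilon> (superlevel P (\<lambda>Q. ennreal c * indicator A Q) d) \<le> ennreal c / \<epsilon> A"
      using assms
      by (auto simp: superlevel_scaled_indicator E_function_def
          intro!: divide_right_mono_ennreal ennreal_leI)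
  qed
  have "ennreal c / \<epsilon> A = ennreal c / \<epsilon> (superlevel P (\<lambda>Q. ennreal c * indicator A Q) c)"
    using assms by (simp add: superlevel_scaled_indicator)
  also have "\<dots> \<le> E_integral P \<epsilon> (\<lambda>Q. ennreal c * indicator A Q)"
    unfolding E_integral_def using assms(2) by (intro SUP_upper) auto
  finally show "ennreal c / \<epsilon> A \<le> E_integral P \<epsilon> (\<lambda>Q. ennreal c * indicator A Q)" .
qed

theorem proposition11:
  fixes M :: "'a measure"
    and P :: "'a measure set"
    and H :: "'a measure set set"
    and \<epsilon> :: "'a measure set \<Rightarrow> ennreal"
    and f :: "'a measure \<Rightarrow> ennreal"
  assumes "P \<subseteq> space (prob_algebra M)"
    and "hypothesis_class P H"
    and "E_function \<epsilon>"
    and "order_measurable P H f"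
  shows "order_measurable P H
           (\<lambda>Q. SUP c\<in>{0::real<..}. ennreal c * indicator (superlevel P f c) Q) \<and>
         (\<forall>c::real. c > 0 \<longrightarrow>
           order_measurable P H (\<lambda>Q. ennreal c * indicator (superlevel P f c) Q)) \<and>
         E_integral P \<epsilon> f =
           E_integral P \<epsilon> (\<lambda>Q. SUP c\<in>{0::real<..}. ennreal c * indicator (superlevel P f c) Q) \<and>
         E_integral P \<epsilon> (\<lambda>Q. SUP c\<in>{0::real<..}. ennreal c * indicator (superlevel P f c) Q) =
           (SUP c\<in>{0::real<..}. E_integral P \<epsilon> (\<lambda>Q. ennreal c * indicator (superlevel P f c) Q)) \<and>
         (SUP c\<in>{0::real<..}. E_integral P \<epsilon> (\<lambda>Q. ennreal c * indicator (superlevel P f c) Q)) =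
           (SUP c\<in>{0::real<..}. ennreal c / \<epsilon> (superlevel P f c))"
proof -
  let ?g = "\<lambda>Q. SUP c\<in>{0::real<..}. ennreal c * indicator (superlevel P f c) Q"
  let ?h = "\<lambda>c Q. ennreal c * indicator (superlevel P f c) Q"
  have sub: "superlevel P f c \<subseteq> P" for c
    by (auto simp: superlevel_def)
  \<comment> \<open>Order-measurability and the E-integral see a function only through its
    superlevel sets, so this equality yields both \<open>g\<close> and \<open>I1\<close>.\<close>
  have sup: "superlevel P ?g = superlevel P f"
    by (intro superlevel_cong SUP_superlevel_eq)
  have g: "order_measurable P H ?g"
    using assms(4) unfolding order_measurable_def sup .
  \<comment> \<open>The empty union; the superlevel sets of a layer above its height are
    empty.\<close>
  have "{} \<in> H"
    using assms(2) unfolding hypothesis_class_def by (metis Union_empty empty_subsetI)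
  then have h: "order_measurable P H (?h c)" if "c > 0" for c
    using assms(4) that sub by (auto simp: order_measurable_def superlevel_scaled_indicator)
  have I1: "E_integral P \<epsilon> f = E_integral P \<epsilon> ?g"
    unfolding E_integral_def sup ..
  have I2: "(SUP c\<in>{0::real<..}. E_integral P \<epsilon> (?h c)) =
      (SUP c\<in>{0::real<..}. ennreal c / \<epsilon> (superlevel P f c))"
    using assms(3) sub by (intro SUP_cong) (auto simp: E_integral_scaled_indicator)
  have I3: "E_integral P \<epsilon> ?g = (SUP c\<in>{0::real<..}. E_integral P \<epsilon> (?h c))"
    unfolding I2 I1[symmetric] by (rule E_integral_def)
  show ?thesis
    using g h I1 I2 I3 by blast
qed

end
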